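(* If $\alpha$ is an ordinal of cofinality $\mathfrak{b}$ and $\varphi$ is a countable typewise decomposable order type, then $$\begin{pmatrix}\alpha\\\varphi\end{pmatrix} \not\longrightarrow \begin{pmatrix}\alpha & 1\\\varphi & \varphi\end{pmatrix}.$$
   Context: An order type is an isomorphism class of linearly ordered sets; ordinals are regarded as order types. For order types $\varphi,\psi$, write $\varphi\leqslant\psi$ if a linearly ordered set of type $\varphi$ embeds order-preservingly into one of type $\psi$. An order type $\varphi$ is typewise decomposable if there are a linearly ordered set $\langle X,<_X\rangle$ and, for every $x\in X$, a linearly ordered set $\langle Y_x,<_x\rangle$, with the $Y_x$ pairwise disjoint, such that $\varphi$ is the order type of the ordered sum $\sum_{x\in X}Y_x$ (the set $\bigcup_{x\in X}Y_x$ ordered by: $a<b$ iff either $a\in Y_x$, $b\in Y_y$ for some $x<_X y$, or $a,b\in Y_x$ and $a<_x b$ for some $x$), while $\varphi\not\leqslant\mathrm{otp}(X)$ and $\varphi\not\leqslant\mathrm{otp}(Y_x)$ for every $x\in X$. For order types $\alpha,\beta,\gamma,\delta,\varepsilon,\zeta$, the polarised partition relation $$\begin{pmatrix} \alpha \\ \beta \end{pmatrix} \longrightarrow \begin{pmatrix} \gamma & \varepsilon \\ \delta & \zeta \end{pmatrix}$$ means: for all linearly ordered sets $A$ of order type $\alpha$ and $B$ of order type $\beta$ and every colouring $c\colon A\times B\to\{0,1\}$, either there are $C\subseteq A$ of order type $\gamma$ and $D\subseteq B$ of order type $\delta$ with $c[C\times D]\subseteq\{0\}$, or there are $E\subseteq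 A$ of order type $\varepsilon$ and $Z\subseteq B$ of order type $\zeta$ with $c[E\times Z]\subseteq\{1\}$ (subsets carry the induced order). A crossed arrow $\not\longrightarrow$ denotes the failure of the relation. For $g,h\colon\omega\to\omega$, $g$ eventually dominates $h$ if $\{n \mid g(n)\leqslant h(n)\}$ is finite. The unbounding number $\mathfrak{b}$ is the smallest cardinality of a family $F$ of functions from $\omega$ to $\omega$ such that no single $h\colon\omega\to\omega$ eventually dominates all members of $F$. *)

theory Defs
  imports "HOL-Library.Countable_Set" "HOL-Library.FuncSet" "HOL-Library.Disjoint_Sets"
begin

unbundle cardinal_syntax

text \<open>
  An order type is given by a representative: a reflexive relation \<open>r\<close> with \<open>Linear_order r\<close>, viewed as
  a linear order on \<open>Field r\<close>. An ordinal is given by a relation \<open>r\<close> with \<open>Well_order r\<close>. The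
  subset \<open>C \<subseteq> Field r\<close> with the induced order is \<open>Restr r C\<close>.
\<close>

text \<open>Although \<open>iso\<close> is introduced in the library for well-orders, by \<open>iso_iff2\<close> it is, for
  arbitrary relations, a bijection between the fields that preserves and reflects the relation.\<close>

definition same_otp :: "'a rel \<Rightarrow> 'b rel \<Rightarrow> bool" where
  "same_otp r s \<longleftrightarrow> (\<exists>f. iso r s f)"

text \<open>For linear orders, an injective monotone map is an order embedding. The library's \<open>embed\<close> is not
  the right notion here, as it asks for an initial segment as image.\<close>

definition otp_le :: "'a rel \<Rightarrow> 'b rel \<Rightarrow> bool" where
  "otp_le r s \<longleftrightarrow> (\<exists>f. inj_on f (Field r) \<and> compat r s f)"

definition one_otp :: "unit rel" where
  "one_otp = {((), ())}"

text \<open>The second disjunct uses the reflexive form of the order on the summands.\<close>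

definition ordered_sum :: "'x rel \<Rightarrow> ('x \<Rightarrow> 'y rel) \<Rightarrow> 'y rel" where
  "ordered_sum X Y = {(a, b). \<exists>x \<in> Field X. \<exists>y \<in> Field X. a \<in> Field (Y x) \<and> b \<in> Field (Y y) \<and>
     ((x \<noteq> y \<and> (x, y) \<in> X) \<or> (x = y \<and> (a, b) \<in> Y x))}"

text \<open>The two type arguments are the types from which the index order and the summands are taken; a
  hypothesis \<open>typewise_decomposable TYPE('x) TYPE('y) \<phi>\<close> with free \<open>'x\<close> and \<open>'y\<close> thus allows
  decompositions over arbitrary types. Empty summands are allowed.\<close>

definition typewise_decomposable :: "'x itself \<Rightarrow> 'y itself \<Rightarrow> 'b rel \<Rightarrow> bool" where
  "typewise_decomposable _ _ \<phi> \<longleftrightarrow>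
     (\<exists>(X :: 'x rel) (Y :: 'x \<Rightarrow> 'y rel).
        Linear_order X \<and> (\<forall>x \<in> Field X. Linear_order (Y x)) \<and>
        disjoint_family_on (\<lambda>x. Field (Y x)) (Field X) \<and>
        same_otp \<phi> (ordered_sum X Y) \<and>
        \<not> otp_le \<phi> X \<and> (\<forall>x \<in> Field X. \<not> otp_le \<phi> (Y x)))"

text \<open>The arguments are listed by columns: \<open>polarised \<alpha> \<beta> \<gamma> \<delta> \<epsilon> \<zeta>\<close> has \<open>\<alpha>\<close> over \<open>\<beta>\<close> on the left of the
  arrow, and \<open>\<gamma>\<close> over \<open>\<delta>\<close> (colour 0) followed by \<open>\<epsilon>\<close> over \<open>\<zeta>\<close> (colour 1) on the right. The
  orders \<open>A\<close> and \<open>B\<close> range over the types of \<open>\<alpha>\<close> and \<open>\<beta>\<close>; this is no restriction, since the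
  condition on \<open>A\<close> and \<open>B\<close> is invariant under isomorphism.\<close>

definition polarised ::
  "'a rel \<Rightarrow> 'b rel \<Rightarrow> 'c rel \<Rightarrow> 'd rel \<Rightarrow> 'e rel \<Rightarrow> 'f rel \<Rightarrow> bool" where
  "polarised \<alpha> \<beta> \<gamma> \<delta> \<epsilon> \<zeta> \<longleftrightarrow>
     (\<forall>(A :: 'a rel) (B :: 'b rel) (c :: 'a \<times> 'b \<Rightarrow> nat).
        Linear_order A \<and> same_otp A \<alpha> \<and> Linear_order B \<and> same_otp B \<beta> \<and>
        c \<in> Field A \<times> Field B \<rightarrow> {0, 1} \<longrightarrow>
        (\<exists>C D. C \<subseteq> Field A \<and> D \<subseteq> Field B \<and> same_otp (Restr A C) \<gamma> \<and> same_otp (Restr B D) \<delta> \<and>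
           c ` (C \<times> D) \<subseteq> {0}) \<or>
        (\<exists>E Z. E \<subseteq> Field A \<and> Z \<subseteq> Field B \<and> same_otp (Restr A E) \<epsilon> \<and> same_otp (Restr B Z) \<zeta> \<and>
           c ` (E \<times> Z) \<subseteq> {1}))"

definition eventually_dominates :: "(nat \<Rightarrow> nat) \<Rightarrow> (nat \<Rightarrow> nat) \<Rightarrow> bool" where
  "eventually_dominates g h \<longleftrightarrow> finite {n. g n \<le> h n}"

definition unbounded_family :: "(nat \<Rightarrow> nat) set \<Rightarrow> bool" where
  "unbounded_family F \<longleftrightarrow> \<not> (\<exists>h. \<forall>f \<in> F. eventually_dominates h f)"

text \<open>Cardinals are represented by cardinal well-orders, up to \<open>=o\<close>.\<close>

definition unbounding_number :: "(nat \<Rightarrow> nat) rel" where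
  "unbounding_number = |SOME F. unbounded_family F \<and> (\<forall>G. unbounded_family G \<longrightarrow> |F| \<le>o |G| )|"

lemma unbounding_number:
  shows "\<exists>F. unbounded_family F \<and> unbounding_number =o |F|"
    and "unbounded_family G \<Longrightarrow> unbounding_number \<le>o |G|"
proof -
  have "\<not> eventually_dominates h h" for h
    by (simp add: eventually_dominates_def)
  then have "unbounded_family UNIV"
    by (auto simp: unbounded_family_def)
  then have "card_of ` Collect unbounded_family \<noteq> {}"
    by auto
  then have "\<exists>r \<in> card_of ` Collect unbounded_family.
      \<forall>r' \<in> card_of ` Collect unbounded_family. r \<le>o r'"
    by (rule exists_minim_Card_order) (auto simp: card_of_Card_order)
  then have ex: "\<exists>F. unbounded_family F \<and> (\<forall>G. unbounded_family G \<longrightarrow> |F| \<le>o |G| )"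
    by auto
  note F = someI_ex[OF ex, folded unbounding_number_def]
  show "\<exists>F. unbounded_family F \<and> unbounding_number =o |F|"
    using F unfolding unbounding_number_def by (blast intro: card_of_refl)
  show "unbounded_family G \<Longrightarrow> unbounding_number \<le>o |G|"
    using F by blast
qed

text \<open>The library's \<open>cofinal\<close> is strict, so it admits no cofinal subset of a successor ordinal.\<close>

definition cofinal_subset :: "'a set \<Rightarrow> 'a rel \<Rightarrow> bool" where
  "cofinal_subset C r \<longleftrightarrow> C \<subseteq> Field r \<and> (\<forall>a \<in> Field r. \<exists>b \<in> C. (a, b) \<in> r)"

text \<open>The cofinality of \<open>\<alpha>\<close> is the least order type of a cofinal subset.\<close>

definition has_cofinality :: "'a rel \<Rightarrow> 'k rel \<Rightarrow> bool" where
  "has_cofinality \<alpha> \<kappa> \<longleftrightarrow>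
     (\<exists>C. cofinal_subset C \<alpha> \<and> Restr \<alpha> C =o \<kappa>) \<and>
     (\<forall>C. cofinal_subset C \<alpha> \<longrightarrow> \<kappa> \<le>o Restr \<alpha> C)"

end

theory Submission
  imports Defs "HOL.Rat" "HOL-Library.Infinite_Set"
begin

text \<open>
  Call a subset of \<open>\<phi>\<close> small if \<open>\<phi>\<close> does not embed into it. It suffices to assign to every
  \<open>a \<in> \<alpha>\<close> a small subset of \<open>\<phi>\<close> such that every copy of \<open>\<phi>\<close> meets the sets assigned to all
  \<open>a\<close> beyond some bound: colour \<open>(a, y)\<close> with 1 iff \<open>y\<close> is in the set assigned to \<open>a\<close>. A copy
  of \<open>\<phi>\<close> is never homogeneous for colour 1, and if it is homogeneous for colour 0 together
  with \<open>C \<subseteq> \<alpha>\<close>, then \<open>C\<close> is not cofinal and hence not of type \<open>\<alpha>\<close>.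

  If \<open>\<phi>\<close> is the union of two small sets, assign one of them to every \<open>a\<close>. Otherwise the small
  sets form a proper ideal. Typewise decomposability says that all summands and all transversals
  of the summands are in this ideal. It follows that \<open>\<phi>\<close> is much simpler than the given
  decomposition, as all its initial segments are small or all its final segments are small
  (\<open>small_segments\<close>): otherwise \<open>\<phi>\<close> would embed into a transversal, by the argument that embeds
  every countable order into the rationals. Suppose the initial segments are small and enumerate
  \<open>\<phi>\<close>. Let \<open>l p\<close> be the number of the first point that is at least \<open>p\<close>. A monotone function
  \<open>f\<close> on the natural numbers determines the set \<open>Z f\<close> of all points \<open>p\<close> with number at most
  \<open>f (l p)\<close>. Its initial segments are finite, so it has type at most \<open>\<omega>\<close> and is small, since
  \<open>\<phi>\<close> is infinite and not of type \<open>\<omega>\<close>. As \<open>l\<close> is unbounded on every copy \<open>D\<close> of \<open>\<phi>\<close>, there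
  is a function \<open>g\<close> such that \<open>Z f\<close> meets \<open>D\<close> unless \<open>f\<close> is everywhere below \<open>g\<close>.

  Finally, an ordinal \<open>\<alpha>\<close> of cofinality \<open>\<bb>\<close> carries monotone functions \<open>f a\<close> such that no \<open>g\<close>
  is everywhere above \<open>f a\<close> for cofinally many \<open>a\<close> (\<open>unbounded_assignment\<close>). The sets
  \<open>Z (f a)\<close> are as required.
\<close>

section \<open>Embeddings between linear orders\<close>

definition embeds :: "'a::linorder set \<Rightarrow> 'b::linorder set \<Rightarrow> bool" where
  "embeds P S \<longleftrightarrow> (\<exists>f. strict_mono_on P f \<and> f ` P \<subseteq> S)"

lemma embedsI:
  assumes "\<And>p. p \<in> P \<Longrightarrow> f p \<in> S"
    and "\<And>p q. p \<in> P \<Longrightarrow> q \<in> P \<Longrightarrow> p < q \<Longrightarrow> f p < f q"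
  shows "embeds P S"
  unfolding embeds_def using assms by (intro exI[of _ f]) (auto intro: strict_mono_onI)

lemma embedsE:
  assumes "embeds P S"
  obtains f where "\<And>p. p \<in> P \<Longrightarrow> f p \<in> S"
    and "\<And>p q. p \<in> P \<Longrightarrow> q \<in> P \<Longrightarrow> p < q \<Longrightarrow> f p < f q"
  using assms unfolding embeds_def by (auto dest: strict_mono_onD)

lemma embeds_refl: "embeds P P"
  by (rule embedsI[of _ id]) auto

lemma embeds_trans:
  assumes "embeds P S" "embeds S T"
  shows "embeds P T"
proof -
  obtain f where f: "\<And>p. p \<in> P \<Longrightarrow> f p \<in> S" "\<And>p q. p \<in> P \<Longrightarrow> q \<in> P \<Longrightarrow> p < q \<Longrightarrow> f p < f q"
    using assms(1) embedsE by blast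
  obtain g where g: "\<And>p. p \<in> S \<Longrightarrow> g p \<in> T" "\<And>p q. p \<in> S \<Longrightarrow> q \<in> S \<Longrightarrow> p < q \<Longrightarrow> g p < g q"
    using assms(2) embedsE by blast
  show ?thesis
    by (rule embedsI[of _ "g \<circ> f"]) (auto simp: f g)
qed

lemma embeds_subset: "S \<subseteq> T \<Longrightarrow> embeds S T"
  by (rule embedsI[of _ id]) auto

lemma embeds_mono: "embeds P S \<Longrightarrow> S \<subseteq> T \<Longrightarrow> embeds P T"
  using embeds_trans embeds_subset by blast

lemma embeds_uminus_iff:
  fixes P S :: "'a::linordered_ab_group_add set"
  shows "embeds (uminus ` P) (uminus ` S) \<longleftrightarrow> embeds P S"
proof -
  have refl: "embeds (uminus ` A) (uminus ` B)" if AB: "embeds A B" for A B :: "'a set"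
  proof -
    obtain f where "\<And>p. p \<in> A \<Longrightarrow> f p \<in> B" "\<And>p q. p \<in> A \<Longrightarrow> q \<in> A \<Longrightarrow> p < q \<Longrightarrow> f p < f q"
      using embedsE[OF AB] by blast
    then show ?thesis
      by (intro embedsI[of _ "\<lambda>p. - f (- p)"]) auto
  qed
  from refl[of P S] refl[of "uminus ` P" "uminus ` S"] show ?thesis
    by (auto simp: image_image)
qed

text \<open>The forth half of Cantor's back-and-forth argument. The relation \<open>prec\<close> is any relation
  in which finite cuts can be filled: besides the order of the rationals, the proof below uses
  the relation between two points whose interval contains a copy of the whole order.\<close>

lemma countable_order_maps_into_dense:
  fixes less :: "'a \<Rightarrow> 'a \<Rightarrow> bool" and prec :: "'b \<Rightarrow> 'b \<Rightarrow> bool"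
  assumes "countable P"
    and trans: "\<And>x y z. x \<in> P \<Longrightarrow> y \<in> P \<Longrightarrow> z \<in> P \<Longrightarrow> less x y \<Longrightarrow> less y z \<Longrightarrow> less x z"
    and irrefl: "\<And>x. x \<in> P \<Longrightarrow> \<not> less x x"
    and fill: "\<And>A B. finite A \<Longrightarrow> finite B \<Longrightarrow> A \<subseteq> T \<Longrightarrow> B \<subseteq> T \<Longrightarrow>
      (\<And>a b. a \<in> A \<Longrightarrow> b \<in> B \<Longrightarrow> prec a b) \<Longrightarrow>
      \<exists>c\<in>T. (\<forall>a\<in>A. prec a c) \<and> (\<forall>b\<in>B. prec c b)"
  obtains f where "\<And>p. p \<in> P \<Longrightarrow> f p \<in> T"
    and "\<And>p q. p \<in> P \<Longrightarrow> q \<in> P \<Longrightarrow> less p q \<Longrightarrow> prec (f p) (f q)"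
proof -
  define k where "k = to_nat_on P"
  have inj: "inj_on k P"
    unfolding k_def using \<open>countable P\<close> by (rule inj_on_to_nat_on)
  have fin: "finite {z \<in> P. k z < n}" for n
    by (rule finite_imageD[of k]) (auto intro: finite_subset[of _ "{..<n}"] inj_on_subset[OF inj])
  define Q where "Q f x r \<longleftrightarrow> (x \<in> P \<longrightarrow> r \<in> T \<and>
      (\<forall>z\<in>P. k z < k x \<longrightarrow> (less z x \<longrightarrow> prec (f z) r) \<and> (less x z \<longrightarrow> prec r (f z))))"
    for f :: "'a \<Rightarrow> 'b" and x r
  have "\<exists>f. \<forall>x. Q f x (f x)"
  proof (rule dependent_wf_choice[of "measure k"])
    show "Q f x r = Q g x r" if "\<And>z. (z, x) \<in> measure k \<Longrightarrow> f z = g z" for f g x r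
      using that unfolding Q_def by auto
  next
    fix x f
    assume IH: "\<And>y. (y, x) \<in> measure k \<Longrightarrow> Q f y (f y)"
    show "\<exists>r. Q f x r"
    proof (cases "x \<in> P")
      case False
      then show ?thesis by (simp add: Q_def)
    next
      case True
      let ?A = "{z \<in> P. k z < k x \<and> less z x}" and ?B = "{z \<in> P. k z < k x \<and> less x z}"
      have "\<exists>c\<in>T. (\<forall>a\<in>f ` ?A. prec a c) \<and> (\<forall>b\<in>f ` ?B. prec c b)"
      proof (rule fill)
        show "finite (f ` ?A)" "finite (f ` ?B)"
          by (auto intro: finite_subset[OF _ fin[of "k x"]])
        show "f ` ?A \<subseteq> T" "f ` ?B \<subseteq> T"
          using IH by (auto simp: Q_def)
        fix a b assume "a \<in> f ` ?A" "b \<in> f ` ?B"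
        then obtain z w where z: "z \<in> P" "k z < k x" "less z x" "a = f z"
          and w: "w \<in> P" "k w < k x" "less x w" "b = f w" by auto
        have "less z w" using trans[OF z(1) True w(1)] z w by blast
        then have "k z \<noteq> k w"
          using irrefl[OF w(1)] inj z(1) w(1) by (auto dest: inj_onD)
        moreover have "Q f z (f z)" "Q f w (f w)" using IH z w by auto
        ultimately show "prec a b"
          using z w \<open>less z w\<close> unfolding Q_def by (metis linorder_neqE_nat)
      qed
      then obtain c where "c \<in> T" "\<forall>a\<in>f ` ?A. prec a c" "\<forall>b\<in>f ` ?B. prec c b" by (elim bexE conjE)
      then have "Q f x c" unfolding Q_def by simp
      then show ?thesis ..
    qed
  qed simp
  then obtain f where f: "\<And>x. Q f x (f x)" by blast
  have "prec (f p) (f q)" if "p \<in> P" "q \<in> P" "less p q" for p q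
  proof -
    have "k p \<noteq> k q"
      using irrefl[of p] inj that by (auto dest: inj_onD)
    then show ?thesis
      using f[of p] f[of q] that unfolding Q_def by (metis linorder_neqE_nat)
  qed
  with f that show thesis unfolding Q_def by blast
qed

lemma rat_fills_finite_cuts:
  fixes A B :: "rat set"
  assumes "finite A" "finite B" "\<And>a b. a \<in> A \<Longrightarrow> b \<in> B \<Longrightarrow> a < b"
  shows "\<exists>c. (\<forall>a\<in>A. a < c) \<and> (\<forall>b\<in>B. c < b)"
proof -
  obtain l where l: "\<And>b. b \<in> B \<Longrightarrow> l < b"
    using lt_ex[of "Min (insert 0 B)"] \<open>finite B\<close> by (auto simp: less_le_trans)
  obtain u where u: "\<And>a. a \<in> A \<Longrightarrow> a < u"
    using gt_ex[of "Max (insert 0 A)"] \<open>finite A\<close> by (auto simp: le_less_trans)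
  show ?thesis
  proof (cases "A = {} \<or> B = {}")
    case True
    then show ?thesis using l u by auto
  next
    case False
    then have "Max A < Min B" using assms by auto
    then obtain c where "Max A < c" "c < Min B" using dense by blast
    then show ?thesis using assms False by auto
  qed
qed

text \<open>Here \<open>P\<close> has type at most \<open>\<omega>\<close> and \<open>S\<close> has type \<open>\<omega>\<close>. The number of predecessors
  identifies \<open>P\<close> and \<open>S\<close> with sets of natural numbers.\<close>

lemma embeds_if_finite_initial_segments:
  fixes P :: "'a::linorder set" and S :: "'b::linorder set"
  assumes P: "\<And>p. p \<in> P \<Longrightarrow> finite (P \<inter> {..p})"
    and S: "\<And>s. s \<in> S \<Longrightarrow> finite (S \<inter> {..s})" and "infinite S"
  shows "embeds P S"
proof -
  define r where "r p = card (P \<inter> {..p})" for p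
  define t where "t s = card (S \<inter> {..s})" for s
  have r: "r p < r q" if "p \<in> P" "q \<in> P" "p < q" for p q
  proof -
    have "P \<inter> {..p} \<subseteq> P \<inter> {..q}" "q \<in> P \<inter> {..q}" "q \<notin> P \<inter> {..p}" using that by auto
    then show ?thesis unfolding r_def using P[OF that(2)] by (metis psubset_card_mono psubsetI)
  qed
  have t: "t p < t q" if "p \<in> S" "q \<in> S" "p < q" for p q
  proof -
    have "S \<inter> {..p} \<subseteq> S \<inter> {..q}" "q \<in> S \<inter> {..q}" "q \<notin> S \<inter> {..p}" using that by auto
    then show ?thesis unfolding t_def using S[OF that(2)] by (metis psubset_card_mono psubsetI)
  qed
  have inj: "inj_on t S"
    by (rule inj_onI) (metis t less_irrefl linorder_neqE)
  then have inf: "infinite (t ` S)" using \<open>infinite S\<close> finite_imageD by blast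
  define h where "h p = inv_into S t (enumerate (t ` S) (r p))" for p
  have h: "h p \<in> S" "t (h p) = enumerate (t ` S) (r p)" for p
    unfolding h_def using enumerate_in_set[OF inf]
    by (auto intro: inv_into_into f_inv_into_f)
  show ?thesis
  proof (rule embedsI)
    fix p q assume pq: "p \<in> P" "q \<in> P" "p < q"
    then have "t (h p) < t (h q)"
      unfolding h using r inf by (simp add: enumerate_mono)
    then show "h p < h q"
      using t[of "h q" "h p"] h(1) by (metis less_asym less_irrefl linorder_neqE)
  qed (rule h)
qed

section \<open>Decomposed countable orders and their small subsets\<close>

text \<open>The set \<open>P\<close> represents a countable order \<open>\<phi>\<close>, and \<open>idx\<close> maps a point to the index of its
  summand; a subset on which \<open>idx\<close> is injective embeds into the index order, whence the condition
  on transversals. Sets of rationals have the advantage that the reverse order is obtained by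
  negation.\<close>

locale decomposed_order =
  fixes P :: "rat set" and idx :: "rat \<Rightarrow> 'x"
  assumes convex_fibre: "p \<in> P \<Longrightarrow> q \<in> P \<Longrightarrow> r \<in> P \<Longrightarrow> p \<le> q \<Longrightarrow> q \<le> r \<Longrightarrow>
      idx p = idx r \<Longrightarrow> idx q = idx p"
    and fibre_small: "\<not> embeds P {p \<in> P. idx p = x}"
    and transversal_small: "T \<subseteq> P \<Longrightarrow> inj_on idx T \<Longrightarrow> \<not> embeds P T"
begin

lemma nonempty: "P \<noteq> {}"
  using transversal_small[of "{}"] embeds_refl by auto

lemma not_embeds_empty: "\<not> embeds P ({} :: rat set)"
  using transversal_small[of "{}"] by auto

lemma decomposed_order_uminus: "decomposed_order (uminus ` P) (idx \<circ> uminus)"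
proof -
  have neg: "embeds (uminus ` P) S \<longleftrightarrow> embeds P (uminus ` S)" for S :: "rat set"
    using embeds_uminus_iff[of P "uminus ` S"] by (simp add: image_image)
  show ?thesis
  proof
    fix p q r
    assume "p \<in> uminus ` P" "q \<in> uminus ` P" "r \<in> uminus ` P" "p \<le> q" "q \<le> r"
      "(idx \<circ> uminus) p = (idx \<circ> uminus) r"
    then show "(idx \<circ> uminus) q = (idx \<circ> uminus) p"
      using convex_fibre[of "- r" "- q" "- p"] by auto
  next
    fix x
    have "uminus ` {p \<in> uminus ` P. (idx \<circ> uminus) p = x} = {p \<in> P. idx p = x}"
      by force
    then show "\<not> embeds (uminus ` P) {p \<in> uminus ` P. (idx \<circ> uminus) p = x}"
      unfolding neg using fibre_small by simp
  next
    fix T assume "T \<subseteq> uminus ` P" "inj_on (idx \<circ> uminus) T"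
    then have "uminus ` T \<subseteq> P" "inj_on idx (uminus ` T)"
      by (auto simp: inj_on_def)
    then show "\<not> embeds (uminus ` P) T"
      unfolding neg by (rule transversal_small)
  qed
qed

end

text \<open>Indivisibility turns the sets into which \<open>P\<close> does not embed into an ideal, which contains
  the finite sets.\<close>

locale indivisible_decomposed_order = decomposed_order +
  assumes indivisible: "S \<subseteq> P \<Longrightarrow> embeds P S \<or> embeds P (P - S)"
begin

lemma embeds_Un:
  assumes "embeds P (S \<union> T)"
  shows "embeds P S \<or> embeds P T"
proof -
  obtain f where f: "\<And>p. p \<in> P \<Longrightarrow> f p \<in> S \<union> T"
    "\<And>p q. p \<in> P \<Longrightarrow> q \<in> P \<Longrightarrow> p < q \<Longrightarrow> f p < f q" using embedsE[OF assms] by blast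
  let ?A = "{p \<in> P. f p \<in> S}"
  have "embeds ?A S"
    by (rule embedsI[of _ f]) (auto simp: f)
  moreover have "embeds (P - ?A) T"
    by (rule embedsI[of _ f]) (use f in auto)
  ultimately show ?thesis
    using indivisible[of ?A] embeds_trans by blast
qed

lemma embeds_UN_finite:
  fixes S :: "_ \<Rightarrow> rat set"
  assumes "finite I" "embeds P (\<Union>i\<in>I. S i)"
  shows "\<exists>i\<in>I. embeds P (S i)"
  using assms by (induction I) (auto simp: not_embeds_empty dest!: embeds_Un)

lemma not_embeds_finite:
  assumes "finite S" "S \<subseteq> P"
  shows "\<not> embeds P S"
proof
  assume "embeds P S"
  then have "embeds P (\<Union>s\<in>S. {s})" by simp
  then obtain s where "s \<in> S" "embeds P {s}" using embeds_UN_finite \<open>finite S\<close> by meson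
  then show False using transversal_small[of "{s}"] \<open>S \<subseteq> P\<close> by auto
qed

text \<open>Otherwise \<open>P\<close> itself would have type \<open>\<omega>\<close> and hence embed into each of its infinite
  subsets; but one of the fibres is infinite, or else there is an infinite transversal. This is
  where \<open>\<omega>\<close> is seen not to be typewise decomposable.\<close>

lemma not_embeds_finite_initial_segments:
  assumes "S \<subseteq> P" and S: "\<And>s. s \<in> S \<Longrightarrow> finite (S \<inter> {..s})"
  shows "\<not> embeds P S"
proof
  assume "embeds P S"
  then obtain f where f: "\<And>p. p \<in> P \<Longrightarrow> f p \<in> S"
    "\<And>p q. p \<in> P \<Longrightarrow> q \<in> P \<Longrightarrow> p < q \<Longrightarrow> f p < f q" using embedsE by blast
  have P: "finite (P \<inter> {..p})" if "p \<in> P" for p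
  proof (rule finite_imageD[of f])
    have "f ` (P \<inter> {..p}) \<subseteq> S \<inter> {..f p}"
      using f that by (force simp: order.order_iff_strict)
    then show "finite (f ` (P \<inter> {..p}))"
      using S[OF f(1)[OF that]] finite_subset by blast
    show "inj_on f (P \<inter> {..p})"
      by (rule inj_onI) (metis IntD1 f(2) less_irrefl linorder_neqE)
  qed
  have inf: "embeds P T" if "T \<subseteq> P" "infinite T" for T
    using P that
    by (intro embeds_if_finite_initial_segments) (auto intro: finite_subset[of "T \<inter> {.._}" "P \<inter> {.._}"])
  have fibres: "finite {p \<in> P. idx p = x}" for x
    using inf[of "{p \<in> P. idx p = x}"] fibre_small by auto
  define T where "T = inv_into P idx ` (idx ` P)"
  have "T \<subseteq> P" unfolding T_def by (auto intro: inv_into_into)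
  moreover have "inj_on idx T"
    unfolding T_def by (auto intro!: inj_onI simp: f_inv_into_f)
  moreover have "idx ` T = idx ` P"
    unfolding T_def image_image by (rule image_cong) (simp_all add: f_inv_into_f)
  ultimately have "finite (idx ` P)"
    using inf transversal_small by (metis finite_imageI)
  then have "finite (\<Union>x\<in>idx ` P. {p \<in> P. idx p = x})"
    using fibres by blast
  then have "finite P" by (rule finite_subset[rotated]) auto
  then show False using not_embeds_finite embeds_refl by blast
qed

text \<open>Suppose there is no such \<open>A\<close>, and say that \<open>a\<close> is far below \<open>b\<close> if \<open>P\<close> embeds into the
  interval between them. The points of this interval that are not far above \<open>a\<close> form a set with
  small initial segments, and those that are not far below \<open>b\<close> form a set with small final
  segments. So both sets are small and do not cover the interval, and a point outside of them is
  far from both \<open>a\<close> and \<open>b\<close>. This density yields a map from \<open>P\<close> to \<open>P\<close> such that smaller points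
  are sent far below larger ones. Fibres are convex and small, hence points far apart lie in
  distinct fibres, and the image of this map is a transversal that contains a copy of \<open>P\<close>.\<close>

lemma large_subset_with_small_segments:
  "\<exists>A\<subseteq>P. embeds P A \<and>
    ((\<forall>a\<in>A. \<not> embeds P (A \<inter> {..a})) \<or> (\<forall>a\<in>A. \<not> embeds P (A \<inter> {a..})))"
proof (rule ccontr)
  assume contra: "\<not> ?thesis"
  have initial: "\<not> embeds P A" if "A \<subseteq> P" "\<And>a. a \<in> A \<Longrightarrow> \<not> embeds P (A \<inter> {..a})" for A
    using contra that by blast
  have final: "\<not> embeds P A" if "A \<subseteq> P" "\<And>a. a \<in> A \<Longrightarrow> \<not> embeds P (A \<inter> {a..})" for A
    using contra that by blast
  define far where "far a b \<longleftrightarrow> embeds P (P \<inter> {a..b})" for a b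
  have above: "\<not> embeds P {p \<in> P. a \<le> p \<and> \<not> far a p}" for a
  proof (rule initial)
    fix p assume "p \<in> {p \<in> P. a \<le> p \<and> \<not> far a p}"
    then have "\<not> embeds P (P \<inter> {a..p})" by (simp add: far_def)
    then show "\<not> embeds P ({p \<in> P. a \<le> p \<and> \<not> far a p} \<inter> {..p})"
      by (rule contrapos_nn) (erule embeds_mono, auto)
  qed auto
  have below: "\<not> embeds P {p \<in> P. p \<le> b \<and> \<not> far p b}" for b
  proof (rule final)
    fix p assume "p \<in> {p \<in> P. p \<le> b \<and> \<not> far p b}"
    then have "\<not> embeds P (P \<inter> {p..b})" by (simp add: far_def)
    then show "\<not> embeds P ({p \<in> P. p \<le> b \<and> \<not> far p b} \<inter> {p..})"
      by (rule contrapos_nn) (erule embeds_mono, auto)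
  qed auto
  have far_less: "a < b" if "a \<in> P" "b \<in> P" "far a b" for a b
  proof (rule ccontr)
    assume "\<not> a < b"
    then have "P \<inter> {a..b} \<subseteq> {a}" by auto
    then have "embeds P {a}" using that(3) embeds_mono unfolding far_def by blast
    then show False using not_embeds_finite[of "{a}"] that by simp
  qed
  have far_widen: "far a' b'" if "far a b" "a' \<le> a" "b \<le> b'" for a b a' b'
    proof -
    have "P \<inter> {a..b} \<subseteq> P \<inter> {a'..b'}" using that by auto
    then show ?thesis using that(1) embeds_mono unfolding far_def by blast
  qed
  have dense: "\<exists>c\<in>P. far a c \<and> far c b" if "far a b" for a b
  proof (rule ccontr)
    assume "\<not> ?thesis"
    then have "P \<inter> {a..b} \<subseteq> {p \<in> P. a \<le> p \<and> \<not> far a p} \<union> {p \<in> P. p \<le> b \<and> \<not> far p b}"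
      by auto
    then show False
      using embeds_Un embeds_mono that above below unfolding far_def by blast
  qed
  obtain p0 where "p0 \<in> P" using nonempty by blast
  have "\<exists>b\<in>P. \<exists>a\<in>P. far a b"
  proof (rule ccontr)
    assume "\<not> ?thesis"
    then have "P \<subseteq> {p \<in> P. p0 \<le> p \<and> \<not> far p0 p} \<union> {p \<in> P. p \<le> p0 \<and> \<not> far p p0}"
      using \<open>p0 \<in> P\<close> by auto
    then show False
      using embeds_Un embeds_mono[OF embeds_refl] above below by blast
  qed
  then obtain a0 b0 where ab: "a0 \<in> P" "b0 \<in> P" "far a0 b0" by blast
  define T where "T = {p \<in> P. far a0 p \<and> far p b0}"
  obtain h where h: "\<And>p. p \<in> P \<Longrightarrow> h p \<in> T"
    "\<And>p q. p \<in> P \<Longrightarrow> q \<in> P \<Longrightarrow> p < q \<Longrightarrow> far (h p) (h q)"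
  proof (rule countable_order_maps_into_dense[of P "(<)" T far])
    fix A B
    assume AB: "finite A" "finite B" "A \<subseteq> T" "B \<subseteq> T" "\<And>a b. a \<in> A \<Longrightarrow> b \<in> B \<Longrightarrow> far a b"
    \<comment> \<open>With the endpoints included, both sides of the cut are nonempty, so that only the
      largest element of one and the smallest element of the other matter.\<close>
    let ?A = "insert a0 A" and ?B = "insert b0 B"
    have "Max ?A \<in> ?A" "Min ?B \<in> ?B" using AB by (intro Max_in Min_in; simp)+
    moreover have "far a b" if "a \<in> ?A" "b \<in> ?B" for a b
      using that AB ab unfolding T_def by auto
    ultimately have "far (Max ?A) (Min ?B)" by blast
    then obtain c where c: "c \<in> P" "far (Max ?A) c" "far c (Min ?B)" using dense by blast
    have "far a c" if "a \<in> ?A" for a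
      using far_widen[OF c(2)] AB that by (meson Max_ge finite.insertI order_refl)
    moreover have "far c b" if "b \<in> ?B" for b
      using far_widen[OF c(3)] AB that by (meson Min_le finite.insertI order_refl)
    ultimately show "\<exists>c\<in>T. (\<forall>a\<in>A. far a c) \<and> (\<forall>b\<in>B. far c b)"
      using c(1) unfolding T_def by blast
  qed (use countableI_type in \<open>auto simp: T_def\<close>)
  have hP: "h p \<in> P" if "p \<in> P" for p using h(1) that unfolding T_def by blast
  have "inj_on idx (h ` P)"
  proof (rule inj_onI)
    have "idx (h p) \<noteq> idx (h q)" if "p \<in> P" "q \<in> P" "p < q" for p q
    proof
      assume *: "idx (h p) = idx (h q)"
      have "P \<inter> {h p..h q} \<subseteq> {r \<in> P. idx r = idx (h p)}"
      proof
        fix r assume "r \<in> P \<inter> {h p..h q}"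
        then show "r \<in> {r \<in> P. idx r = idx (h p)}"
          using convex_fibre[OF hP[OF that(1)] _ hP[OF that(2)] _ _ *, of r] by simp
      qed
      then show False
        using h(2)[OF that] fibre_small embeds_mono unfolding far_def by blast
    qed
    then have "p = q" if "p \<in> P" "q \<in> P" "idx (h p) = idx (h q)" for p q
      using that by (metis linorder_neqE)
    then show "x = y" if "x \<in> h ` P" "y \<in> h ` P" "idx x = idx y" for x y
      using that by blast
  qed
  moreover have "embeds P (h ` P)"
    by (rule embedsI[of _ h]) (use h far_less hP in auto)
  ultimately show False
    using transversal_small[of "h ` P"] hP by blast
qed

text \<open>Since \<open>P\<close> embeds into the large subset just found, it inherits the smallness of segments.\<close>

lemma small_segments:
  "(\<forall>p\<in>P. \<not> embeds P (P \<inter> {..p})) \<or> (\<forall>p\<in>P. \<not> embeds P (P \<inter> {p..}))"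
proof -
  obtain A f where A: "A \<subseteq> P"
    "(\<forall>a\<in>A. \<not> embeds P (A \<inter> {..a})) \<or> (\<forall>a\<in>A. \<not> embeds P (A \<inter> {a..}))"
    and f: "\<And>p. p \<in> P \<Longrightarrow> f p \<in> A" "\<And>p q. p \<in> P \<Longrightarrow> q \<in> P \<Longrightarrow> p < q \<Longrightarrow> f p < f q"
    using large_subset_with_small_segments embedsE by metis
  have "embeds (P \<inter> {..p}) (A \<inter> {..f p})" "embeds (P \<inter> {p..}) (A \<inter> {f p..})" if "p \<in> P" for p
    by (rule embedsI[of _ f]; use f that in \<open>force simp: order.order_iff_strict\<close>)+
  then show ?thesis using A f(1) embeds_trans by meson
qed

end

section \<open>Small sets parametrised by functions on the natural numbers\<close>

text \<open>Into each of the sets \<open>Z f\<close> there is no embedding of \<open>P\<close>, but together they detect the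
  copies of \<open>P\<close>: those \<open>f\<close> for which \<open>Z f\<close> misses a given copy are bounded everywhere by a
  single function. Monotone functions suffice, as the members of an unbounded family may be
  replaced by larger functions.\<close>

definition small_tests :: "rat set \<Rightarrow> ((nat \<Rightarrow> nat) \<Rightarrow> rat set) \<Rightarrow> bool" where
  "small_tests P Z \<longleftrightarrow>
    (\<forall>f. mono f \<longrightarrow> Z f \<subseteq> P \<and> \<not> embeds P (Z f)) \<and>
    (\<forall>D\<subseteq>P. embeds P D \<longrightarrow> (\<exists>g. \<forall>f. mono f \<longrightarrow> Z f \<inter> D = {} \<longrightarrow> (\<forall>n. f n < g n)))"

text \<open>Points are numbered by \<open>k\<close>, and \<open>l p\<close> is the least number of a point at or above \<open>p\<close>. On an
  initial segment the values of \<open>l\<close> are bounded, so \<open>Z f\<close> has finite initial segments. On the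
  other hand, points with bounded values of \<open>l\<close> are covered by finitely many initial segments, so
  a copy of \<open>P\<close> contains points \<open>d n\<close> with \<open>l (d n) \<ge> n\<close>. If \<open>d n\<close> is missed by \<open>Z f\<close>, then its
  number exceeds \<open>f (l (d n))\<close>, and thus also \<open>f n\<close> by monotonicity.\<close>

lemma (in indivisible_decomposed_order) small_tests_if_small_initial_segments:
  assumes init: "\<And>p. p \<in> P \<Longrightarrow> \<not> embeds P (P \<inter> {..p})"
  shows "\<exists>Z. small_tests P Z"
proof -
  define k where "k = to_nat_on P"
  have inj: "inj_on k P"
    unfolding k_def by (rule inj_on_to_nat_on) (rule countableI_type)
  define l where "l p = (LEAST n. \<exists>q\<in>P. p \<le> q \<and> k q = n)" for p
  have l_le: "l p \<le> k q" if "q \<in> P" "p \<le> q" for p q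
    unfolding l_def using that by (blast intro: Least_le)
  have l_attained: "\<exists>q\<in>P. p \<le> q \<and> k q = l p" if "p \<in> P" for p
    unfolding l_def by (rule LeastI_ex) (use that in blast)
  define Z where "Z f = {p \<in> P. k p \<le> f (l p)}" for f :: "nat \<Rightarrow> nat"
  have "\<not> embeds P (Z f)" if "mono f" for f
  proof (rule not_embeds_finite_initial_segments)
    fix s assume "s \<in> Z f"
    then have "s \<in> P" by (simp add: Z_def)
    have "Z f \<inter> {..s} \<subseteq> {p \<in> P. k p \<le> f (k s)}"
      using l_le[OF \<open>s \<in> P\<close>] monoD[OF \<open>mono f\<close>] unfolding Z_def by (auto intro: order_trans)
    moreover have "finite {p \<in> P. k p \<le> f (k s)}"
      by (rule finite_imageD[of k])
        (auto intro: finite_subset[of _ "{..f (k s)}"] inj_on_subset[OF inj])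
    ultimately show "finite (Z f \<inter> {..s})" using finite_subset by blast
  qed (auto simp: Z_def)
  moreover have "\<exists>g. \<forall>f. mono f \<longrightarrow> Z f \<inter> D = {} \<longrightarrow> (\<forall>n. f n < g n)"
    if "D \<subseteq> P" "embeds P D" for D
  proof -
    have "\<exists>d\<in>D. n \<le> l d" for n
    proof (rule ccontr)
      assume *: "\<not> ?thesis"
      let ?I = "{q \<in> P. k q < n}"
      have "finite ?I"
        by (rule finite_imageD[of k]) (auto intro: finite_subset[of _ "{..<n}"] inj_on_subset[OF inj])
      moreover have "D \<subseteq> (\<Union>q\<in>?I. P \<inter> {..q})"
        using * l_attained \<open>D \<subseteq> P\<close> by (force simp: not_le)
      then have "embeds P (\<Union>q\<in>?I. P \<inter> {..q})" using \<open>embeds P D\<close> embeds_mono by blast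
      ultimately show False using embeds_UN_finite[of ?I "\<lambda>q. P \<inter> {..q}"] init by blast
    qed
    then obtain d where d: "\<And>n. d n \<in> D" "\<And>n. n \<le> l (d n)" by metis
    have "f n < k (d n)" if "mono f" "Z f \<inter> D = {}" for f n
    proof -
      have "f n \<le> f (l (d n))" using d(2) \<open>mono f\<close> by (rule monoD[rotated])
      also have "\<dots> < k (d n)"
        using d(1)[of n] that \<open>D \<subseteq> P\<close> unfolding Z_def by (force simp: not_le)
      finally show ?thesis .
    qed
    then show ?thesis by (intro exI[of _ "\<lambda>n. k (d n)"]) blast
  qed
  ultimately show ?thesis
    unfolding small_tests_def by (intro exI[of _ Z]) (auto simp: Z_def)
qed

lemma small_tests_uminus:
  assumes "small_tests (uminus ` P) Z"
  shows "small_tests P (\<lambda>f. uminus ` Z f)"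
proof -
  have swap: "uminus ` A \<subseteq> P \<longleftrightarrow> A \<subseteq> uminus ` P" "embeds P (uminus ` A) \<longleftrightarrow> embeds (uminus ` P) A"
    "uminus ` A \<inter> D = {} \<longleftrightarrow> A \<inter> uminus ` D = {}" for A D :: "rat set"
    using embeds_uminus_iff[of P "uminus ` A"] by (force simp: image_image)+
  show ?thesis
    using assms unfolding small_tests_def swap
    by (metis embeds_uminus_iff image_mono)
qed

text \<open>The case of small final segments is the case of small initial segments for \<open>- P\<close>.\<close>

lemma (in decomposed_order) small_tests_exist: "\<exists>Z. small_tests P Z"
proof (cases "\<forall>S\<subseteq>P. embeds P S \<or> embeds P (P - S)")
  case False
  then obtain S where S: "S \<subseteq> P" "\<not> embeds P S" "\<not> embeds P (P - S)" by blast
  have "S \<inter> D \<noteq> {}" if "D \<subseteq> P" "embeds P D" for D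
    using S(3) embeds_mono[of P D "P - S"] that by blast
  then show ?thesis
    using S unfolding small_tests_def by (intro exI[of _ "\<lambda>_. S"]) blast
next
  case True
  then interpret indivisible_decomposed_order P idx
    by unfold_locales blast
  interpret neg: decomposed_order "uminus ` P" "idx \<circ> uminus"
    by (rule decomposed_order_uminus)
  interpret neg: indivisible_decomposed_order "uminus ` P" "idx \<circ> uminus"
  proof
    fix S assume "S \<subseteq> uminus ` P"
    then have "uminus ` S \<subseteq> P" by auto
    moreover have "uminus ` (P - uminus ` S) = uminus ` P - S"
      by (force simp: image_iff)
    ultimately show "embeds (uminus ` P) S \<or> embeds (uminus ` P) (uminus ` P - S)"
      using indivisible[of "uminus ` S"] embeds_uminus_iff[of P "uminus ` S"]
        embeds_uminus_iff[of P "P - uminus ` S"] by (simp add: image_image)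
  qed
  have reflect: "uminus ` (P \<inter> {p..}) = uminus ` P \<inter> {..- p}" for p
    by (force simp: image_iff)
  from small_segments show ?thesis
  proof
    assume "\<forall>p\<in>P. \<not> embeds P (P \<inter> {..p})"
    then show ?thesis using small_tests_if_small_initial_segments by blast
  next
    assume final: "\<forall>p\<in>P. \<not> embeds P (P \<inter> {p..})"
    have "\<exists>Z. small_tests (uminus ` P) Z"
    proof (rule neg.small_tests_if_small_initial_segments)
      fix p assume "p \<in> uminus ` P"
      then obtain q where "q \<in> P" "p = - q" by blast
      then show "\<not> embeds (uminus ` P) (uminus ` P \<inter> {..p})"
        using final embeds_uminus_iff[of P "P \<inter> {q..}"] by (simp add: reflect)
    qed
    then show ?thesis using small_tests_uminus by blast
  qed
qed

section \<open>Representing a countable typewise decomposable order by rationals\<close>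

lemma otp_leI:
  assumes "Linear_order r" "Linear_order s"
    and m: "\<And>x. x \<in> Field r \<Longrightarrow> m x \<in> Field s"
    and mono: "\<And>x y. (x, y) \<in> r \<Longrightarrow> x \<noteq> y \<Longrightarrow> (m x, m y) \<in> s \<and> m x \<noteq> m y"
  shows "otp_le r s"
proof -
  have "inj_on m (Field r)"
  proof (rule inj_onI, rule ccontr)
    fix x y assume "x \<in> Field r" "y \<in> Field r" "m x = m y" "x \<noteq> y"
    then have "(x, y) \<in> r \<or> (y, x) \<in> r"
      using \<open>Linear_order r\<close> unfolding linear_order_on_def total_on_def by blast
    then show False using mono \<open>m x = m y\<close> \<open>x \<noteq> y\<close> by metis
  qed
  moreover have "compat r s m"
    unfolding compat_def
  proof (intro allI impI)
    fix x y assume xy: "(x, y) \<in> r"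
    show "(m x, m y) \<in> s"
    proof (cases "x = y")
      case True
      then have "m x \<in> Field s" using xy m by (auto simp: Field_def)
      then show ?thesis
        using True \<open>Linear_order s\<close>
        unfolding order_on_defs refl_on_def by blast
    qed (use mono xy in blast)
  qed
  ultimately show ?thesis unfolding otp_le_def by blast
qed

lemma countable_linear_order_into_rat:
  assumes "Linear_order \<phi>" "countable (Field \<phi>)"
  obtains e :: "'b \<Rightarrow> rat"
  where "\<And>x y. x \<in> Field \<phi> \<Longrightarrow> y \<in> Field \<phi> \<Longrightarrow> e x \<le> e y \<longleftrightarrow> (x, y) \<in> \<phi>"
proof -
  note lin = \<open>Linear_order \<phi>\<close>[unfolded order_on_defs]
  obtain e :: "'b \<Rightarrow> rat" where e: "\<And>x y. x \<in> Field \<phi> \<Longrightarrow> y \<in> Field \<phi> \<Longrightarrow> (x, y) \<in> \<phi> \<and> x \<noteq> y \<Longrightarrow> e x < e y"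
  proof (rule countable_order_maps_into_dense[of "Field \<phi>" "\<lambda>x y. (x, y) \<in> \<phi> \<and> x \<noteq> y" UNIV "(<)"])
    show "countable (Field \<phi>)" by fact
    show "(x, z) \<in> \<phi> \<and> x \<noteq> z" if "(x, y) \<in> \<phi> \<and> x \<noteq> y" "(y, z) \<in> \<phi> \<and> y \<noteq> z" for x y z
      using that lin by (meson antisymD transD)
  qed (use rat_fills_finite_cuts in auto)
  have "e x \<le> e y \<longleftrightarrow> (x, y) \<in> \<phi>" if "x \<in> Field \<phi>" "y \<in> Field \<phi>" for x y
  proof (cases "x = y")
    case True
    then show ?thesis using that lin by (auto simp: refl_on_def)
  next
    case False
    then have "(x, y) \<in> \<phi> \<or> (y, x) \<in> \<phi>"
      using that lin unfolding total_on_def by blast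
    then show ?thesis
      using e[OF that] e[OF that(2,1)] False lin by (metis antisymD less_imp_le not_le)
  qed
  with that show thesis by blast
qed

text \<open>An embedding of the rational copy of \<open>\<phi>\<close> into a fibre turns into one of \<open>\<phi>\<close> into the
  corresponding summand, and an embedding into a transversal turns into one into the index
  order. A fibre over an element outside the index order is empty, but \<open>\<phi>\<close> is not, as the empty
  order embeds into every index order.\<close>

lemma typewise_decomposable_imp_decomposed_order:
  fixes e :: "'b \<Rightarrow> rat"
  assumes "Linear_order \<phi>"
    and e: "\<And>x y. x \<in> Field \<phi> \<Longrightarrow> y \<in> Field \<phi> \<Longrightarrow> e x \<le> e y \<longleftrightarrow> (x, y) \<in> \<phi>"
    and "typewise_decomposable TYPE('x) TYPE('y) \<phi>"
  shows "\<exists>idx :: rat \<Rightarrow> 'x. decomposed_order (e ` Field \<phi>) idx"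
proof -
  note lin = \<open>Linear_order \<phi>\<close>[unfolded order_on_defs]
  obtain X :: "'x rel" and Y :: "'x \<Rightarrow> 'y rel" and i where
    X: "Linear_order X" and Y: "\<And>u. u \<in> Field X \<Longrightarrow> Linear_order (Y u)"
    and disj: "disjoint_family_on (\<lambda>u. Field (Y u)) (Field X)"
    and i: "iso \<phi> (ordered_sum X Y) i"
    and nX: "\<not> otp_le \<phi> X" and nY: "\<And>u. u \<in> Field X \<Longrightarrow> \<not> otp_le \<phi> (Y u)"
    using assms(3) unfolding typewise_decomposable_def same_otp_def
    by (elim exE conjE) (metis (no_types, lifting))
  have e_less: "(x, y) \<in> \<phi> \<and> x \<noteq> y" if "x \<in> Field \<phi>" "y \<in> Field \<phi>" "e x < e y" for x y
    using e that by force
  have e_inj: "inj_on e (Field \<phi>)"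
    using e lin by (intro inj_onI) (metis antisymD order_refl)
  have e_strict: "e x < e y" if "(x, y) \<in> \<phi>" "x \<noteq> y" for x y
  proof -
    have "x \<in> Field \<phi>" "y \<in> Field \<phi>" using that by (auto simp: Field_def)
    then show ?thesis using e e_inj that by (metis inj_onD order_le_less)
  qed
  have nonempty: "Field \<phi> \<noteq> {}"
  proof
    assume "Field \<phi> = {}"
    then have "otp_le \<phi> X" by (simp add: otp_le_def compat_def Field_def Domain_unfold)
    then show False using nX by blast
  qed
  have i_inj: "inj_on i (Field \<phi>)" using i by (auto simp: iso_iff2 bij_betw_def)
  have "\<exists>u\<in>Field X. i x \<in> Field (Y u)" if "x \<in> Field \<phi>" for x
  proof -
    have "(x, x) \<in> \<phi>" using that lin by (auto simp: refl_on_def)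
    then have "(i x, i x) \<in> ordered_sum X Y" using i by (rule iso_forward)
    then show ?thesis unfolding ordered_sum_def by blast
  qed
  then obtain b where b: "\<And>x. x \<in> Field \<phi> \<Longrightarrow> b x \<in> Field X"
    "\<And>x. x \<in> Field \<phi> \<Longrightarrow> i x \<in> Field (Y (b x))" by metis
  have b_unique: "u = b x" if "x \<in> Field \<phi>" "u \<in> Field X" "i x \<in> Field (Y u)" for x u
    using disj b[OF that(1)] that unfolding disjoint_family_on_def by blast
  have b_mono: "(b x, b y) \<in> X \<and> (b x = b y \<longrightarrow> (i x, i y) \<in> Y (b x))" if "(x, y) \<in> \<phi>" for x y
  proof -
    have xy: "x \<in> Field \<phi>" "y \<in> Field \<phi>" using that by (auto simp: Field_def)
    have "(i x, i y) \<in> ordered_sum X Y" using that i by (rule iso_forward)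
    then obtain u v where "u \<in> Field X" "v \<in> Field X" "i x \<in> Field (Y u)" "i y \<in> Field (Y v)"
      and uv: "u \<noteq> v \<and> (u, v) \<in> X \<or> u = v \<and> (i x, i y) \<in> Y u"
      unfolding ordered_sum_def by blast
    then have "u = b x" "v = b y" using b_unique xy by blast+
    moreover have "(b x, b x) \<in> X"
      using X b(1)[OF xy(1)] unfolding order_on_defs refl_on_def by blast
    ultimately show ?thesis using uv by auto
  qed
  \<comment> \<open>\<open>b x\<close> is the index of the summand in which \<open>x\<close> lies.\<close>
  define idx where "idx p = b (inv_into (Field \<phi>) e p)" for p
  have idx: "idx (e x) = b x" if "x \<in> Field \<phi>" for x
    unfolding idx_def using e_inj that by simp
  have "decomposed_order (e ` Field \<phi>) idx"
  proof
    fix p q r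
    assume "p \<in> e ` Field \<phi>" "q \<in> e ` Field \<phi>" "r \<in> e ` Field \<phi>" "p \<le> q" "q \<le> r" "idx p = idx r"
    then obtain x y z where *: "x \<in> Field \<phi>" "y \<in> Field \<phi>" "z \<in> Field \<phi>" "p = e x" "q = e y" "r = e z"
      by blast
    then have "(x, y) \<in> \<phi>" "(y, z) \<in> \<phi>" "b x = b z"
      using e \<open>p \<le> q\<close> \<open>q \<le> r\<close> \<open>idx p = idx r\<close> idx by auto
    then have "(b x, b y) \<in> X" "(b y, b x) \<in> X" using b_mono by force+
    then show "idx q = idx p"
      using X * idx unfolding order_on_defs by (metis antisymD)
  next
    fix u
    show "\<not> embeds (e ` Field \<phi>) {p \<in> e ` Field \<phi>. idx p = u}"
    proof
      assume "embeds (e ` Field \<phi>) {p \<in> e ` Field \<phi>. idx p = u}"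
      then obtain f where f: "\<And>p. p \<in> e ` Field \<phi> \<Longrightarrow> f p \<in> {p \<in> e ` Field \<phi>. idx p = u}"
        "\<And>p q. p \<in> e ` Field \<phi> \<Longrightarrow> q \<in> e ` Field \<phi> \<Longrightarrow> p < q \<Longrightarrow> f p < f q"
        using embedsE by blast
      have "\<exists>x'\<in>Field \<phi>. f (e x) = e x' \<and> b x' = u" if "x \<in> Field \<phi>" for x
        using f(1)[of "e x"] that idx by auto
      then obtain h where h: "\<And>x. x \<in> Field \<phi> \<Longrightarrow> h x \<in> Field \<phi>"
        "\<And>x. x \<in> Field \<phi> \<Longrightarrow> f (e x) = e (h x)" "\<And>x. x \<in> Field \<phi> \<Longrightarrow> b (h x) = u" by metis
      obtain x0 where "x0 \<in> Field \<phi>" using nonempty by blast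
      then have u: "u \<in> Field X" using b(1) h by metis
      have "otp_le \<phi> (Y u)"
      proof (rule otp_leI[of _ _ "i \<circ> h"])
        show "(i \<circ> h) x \<in> Field (Y u)" if "x \<in> Field \<phi>" for x
          using b(2) h that by force
        fix x y assume xy: "(x, y) \<in> \<phi>" "x \<noteq> y"
        then have F: "x \<in> Field \<phi>" "y \<in> Field \<phi>" by (auto simp: Field_def)
        have "e (h x) < e (h y)" using f(2) e_strict[OF xy] F h(2) by (metis imageI)
        then have "(h x, h y) \<in> \<phi>" "h x \<noteq> h y" using e_less h(1) F by blast+
        then show "((i \<circ> h) x, (i \<circ> h) y) \<in> Y u \<and> (i \<circ> h) x \<noteq> (i \<circ> h) y"
          using b_mono[of "h x" "h y"] h F i_inj by (auto dest: inj_onD)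
      qed (use assms(1) Y u in auto)
      then show False using nY u by blast
    qed
  next
    fix T assume T: "T \<subseteq> e ` Field \<phi>" "inj_on idx T"
    show "\<not> embeds (e ` Field \<phi>) T"
    proof
      assume "embeds (e ` Field \<phi>) T"
      then obtain f where f: "\<And>p. p \<in> e ` Field \<phi> \<Longrightarrow> f p \<in> T"
        "\<And>p q. p \<in> e ` Field \<phi> \<Longrightarrow> q \<in> e ` Field \<phi> \<Longrightarrow> p < q \<Longrightarrow> f p < f q"
        using embedsE by blast
      have "\<exists>x'\<in>Field \<phi>. f (e x) = e x'" if "x \<in> Field \<phi>" for x
        using f(1)[of "e x"] that T(1) by auto
      then obtain h where h: "\<And>x. x \<in> Field \<phi> \<Longrightarrow> h x \<in> Field \<phi>"
        "\<And>x. x \<in> Field \<phi> \<Longrightarrow> f (e x) = e (h x)" by metis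
      have "otp_le \<phi> X"
      proof (rule otp_leI[of _ _ "b \<circ> h"])
        show "(b \<circ> h) x \<in> Field X" if "x \<in> Field \<phi>" for x
          using b(1) h that by simp
        fix x y assume xy: "(x, y) \<in> \<phi>" "x \<noteq> y"
        then have F: "x \<in> Field \<phi>" "y \<in> Field \<phi>" by (auto simp: Field_def)
        have less: "e (h x) < e (h y)" using f(2) e_strict[OF xy] F h(2) by (metis imageI)
        then have "(h x, h y) \<in> \<phi>" using e_less h(1) F by blast
        moreover have "e (h x) \<in> T" "e (h y) \<in> T" using f(1) F h(2) by (metis imageI)+
        then have "idx (e (h x)) \<noteq> idx (e (h y))" using T(2) less by (metis inj_onD less_irrefl)
        ultimately show "((b \<circ> h) x, (b \<circ> h) y) \<in> X \<and> (b \<circ> h) x \<noteq> (b \<circ> h) y"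
          using b_mono idx h(1) F by simp
      qed (use assms(1) X in auto)
      then show False using nX by blast
    qed
  qed
  then show ?thesis by blast
qed

section \<open>Functions assigned to an ordinal of cofinality \<open>\<bb>\<close>\<close>

lemma cofinal_subset_mono:
  "cofinal_subset C r \<Longrightarrow> C \<subseteq> E \<Longrightarrow> E \<subseteq> Field r \<Longrightarrow> cofinal_subset E r"
  unfolding cofinal_subset_def by blast

text \<open>The increasing enumeration \<open>g\<close> of \<open>C\<close> by \<open>\<alpha>\<close> satisfies \<open>a \<le> g a\<close>, as does every
  strictly increasing map of a well-order into itself.\<close>

lemma cofinal_if_same_otp:
  assumes "Well_order \<alpha>" "C \<subseteq> Field \<alpha>" "same_otp (Restr \<alpha> C) \<alpha>"
  shows "cofinal_subset C \<alpha>"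
proof -
  note wo = \<open>Well_order \<alpha>\<close>[unfolded well_order_on_def order_on_defs]
  have Field_C: "Field (Restr \<alpha> C) = C" using wo assms(2) by (intro Refl_Field_Restr2) auto
  obtain f where f: "iso (Restr \<alpha> C) \<alpha> f" using assms(3) unfolding same_otp_def by blast
  define g where "g = inv_into C f"
  have g_mem: "g a \<in> C" if "a \<in> Field \<alpha>" for a
    using iso_backward_Field[OF that f] unfolding g_def Field_C .
  have g_mono: "(g x, g y) \<in> \<alpha>" if "(x, y) \<in> \<alpha>" for x y
    using iso_backward[OF that f] unfolding g_def Field_C by blast
  have g_inj: "g x \<noteq> g y" if "x \<in> Field \<alpha>" "y \<in> Field \<alpha>" "x \<noteq> y" for x y
    using that iso_Field[OF f] unfolding g_def Field_C by (metis inv_into_injective)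
  have wf: "wf (\<alpha> - Id)" using wo by blast
  have "a \<in> Field \<alpha> \<longrightarrow> (a, g a) \<in> \<alpha>" for a
    using wf
  proof (induction a rule: wf_induct_rule)
    case (less a)
    show ?case
    proof (intro impI, rule ccontr)
      assume a: "a \<in> Field \<alpha>" "(a, g a) \<notin> \<alpha>"
      have ga: "g a \<in> Field \<alpha>" using g_mem a(1) assms(2) by blast
      have lt: "(g a, a) \<in> \<alpha>" "g a \<noteq> a"
        using wo a ga unfolding total_on_def refl_on_def by metis+
      with less.IH ga have "(g a, g (g a)) \<in> \<alpha>" by blast
      moreover have "(g (g a), g a) \<in> \<alpha>" using g_mono lt(1) .
      ultimately show False using g_inj[OF ga a(1) lt(2)] wo by (meson antisymD)
    qed
  qed
  then show ?thesis unfolding cofinal_subset_def using assms(2) g_mem by blast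
qed

text \<open>Index an unbounded family \<open>h\<close> of size \<open>\<bb>\<close> by a cofinal set \<open>C\<close> of type \<open>\<bb>\<close>. Since \<open>\<bb>\<close> is
  a cardinal, fewer than \<open>\<bb>\<close> elements of \<open>C\<close> precede a given \<open>c \<in> C\<close>, so one function \<open>d c\<close>
  dominates the members of the family that they index. Assign to \<open>a\<close> a monotone function that is
  at least \<open>d c\<close> and \<open>h c\<close> for some \<open>c \<ge> a\<close> in \<open>C\<close>. A function above cofinally many of the
  assigned ones dominates the whole family, which is impossible.\<close>

lemma unbounded_assignment:
  assumes "Well_order \<alpha>" "has_cofinality \<alpha> unbounding_number"
  obtains f :: "'a \<Rightarrow> nat \<Rightarrow> nat" where "\<And>a. mono (f a)"
    and "\<And>g. \<not> cofinal_subset {a \<in> Field \<alpha>. \<forall>n. f a n < g n} \<alpha>"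
proof -
  note wo = \<open>Well_order \<alpha>\<close>[unfolded well_order_on_def order_on_defs]
  obtain C where C: "cofinal_subset C \<alpha>" "Restr \<alpha> C =o unbounding_number"
    using assms(2) unfolding has_cofinality_def by blast
  obtain F where F: "unbounded_family F" "unbounding_number =o |F|"
    using unbounding_number(1) by blast
  let ?R = "Restr \<alpha> C"
  have "C \<subseteq> Field \<alpha>" using C(1) unfolding cofinal_subset_def by blast
  then have Field_C: "Field ?R = C" using wo by (intro Refl_Field_Restr2) auto
  have RF: "?R =o |F|" using C(2) F(2) by (rule ordIso_transitive)
  have card: "Card_order ?R" using RF by (rule ordIso_card_of_imp_Card_order)
  have "|C| =o |F|"
    using card_of_Field_ordIso[OF card] RF ordIso_transitive unfolding Field_C by blast
  then obtain h where h: "bij_betw h C F" using card_of_ordIso by blast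
  have "\<not> unbounded_family (h ` underS ?R c)" if "c \<in> C" for c
  proof
    assume "unbounded_family (h ` underS ?R c)"
    then have "unbounding_number \<le>o |h ` underS ?R c|" by (rule unbounding_number(2))
    moreover have "|h ` underS ?R c| <o unbounding_number"
      using card_of_image card_of_underS[OF card, of c] C(2) that
        ordLeq_ordLess_trans ordLess_ordIso_trans unfolding Field_C by blast
    ultimately show False using not_ordLess_ordLeq by blast
  qed
  then have "\<forall>c\<in>C. \<exists>d. \<forall>x\<in>underS ?R c. eventually_dominates d (h x)"
    unfolding unbounded_family_def by simp
  then obtain d where d: "\<And>c x. c \<in> C \<Longrightarrow> x \<in> underS ?R c \<Longrightarrow> eventually_dominates (d c) (h x)"
    by metis
  obtain k where k: "\<And>a. a \<in> Field \<alpha> \<Longrightarrow> k a \<in> C" "\<And>a. a \<in> Field \<alpha> \<Longrightarrow> (a, k a) \<in> \<alpha>"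
    using C(1) unfolding cofinal_subset_def by metis
  \<comment> \<open>Summing up to \<open>n\<close> makes the function monotone. The term \<open>h (k a)\<close> is needed because \<open>d (k a)\<close>
    only takes care of the elements strictly before \<open>k a\<close>.\<close>
  define f where "f a n = (\<Sum>j\<le>n. d (k a) j + h (k a) j)" for a n
  have f_ge: "d (k a) n + h (k a) n \<le> f a n" for a n
    unfolding f_def by (rule member_le_sum) auto
  show thesis
  proof
    show "mono (f a)" for a
      unfolding f_def by (intro monoI sum_mono2) auto
    fix g
    show "\<not> cofinal_subset {a \<in> Field \<alpha>. \<forall>n. f a n < g n} \<alpha>"
    proof
      assume cof: "cofinal_subset {a \<in> Field \<alpha>. \<forall>n. f a n < g n} \<alpha>"
      have "eventually_dominates g (h x)" if "x \<in> C" for x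
      proof -
        have "x \<in> Field \<alpha>" using \<open>C \<subseteq> Field \<alpha>\<close> that by (rule subsetD)
        then obtain a where "a \<in> {a \<in> Field \<alpha>. \<forall>n. f a n < g n}" "(x, a) \<in> \<alpha>"
          using cof unfolding cofinal_subset_def by meson
        then have a: "a \<in> Field \<alpha>" "\<And>n. f a n < g n" "(x, a) \<in> \<alpha>" by simp_all
        have xk: "(x, k a) \<in> \<alpha>" using a(1,3) k(2) wo by (meson transD)
        have bound: "d (k a) n + h (k a) n < g n" for n
          using f_ge a(2) by (rule le_less_trans)
        show ?thesis
        proof (cases "x = k a")
          case True
          have "h x n < g n" for n using bound[of n] True by simp
          then have "{n. g n \<le> h x n} = {}" by (simp add: not_le)
          then show ?thesis unfolding eventually_dominates_def by simp
        next
          case False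
          then have "x \<in> underS ?R (k a)" using xk that k(1) a(1) by (auto simp: underS_def)
          then have "finite {n. d (k a) n \<le> h x n}"
            using d k(1) a(1) unfolding eventually_dominates_def by blast
          moreover have "{n. g n \<le> h x n} \<subseteq> {n. d (k a) n \<le> h x n}"
          proof
            fix n assume "n \<in> {n. g n \<le> h x n}"
            then show "n \<in> {n. d (k a) n \<le> h x n}" using bound[of n] by simp
          qed
          ultimately show ?thesis unfolding eventually_dominates_def by (rule rev_finite_subset)
        qed
      qed
      then have "\<forall>u\<in>F. eventually_dominates g u" using h by (auto simp: bij_betw_def)
      then show False using F(1) unfolding unbounded_family_def by blast
    qed
  qed
qed

section \<open>The colouring\<close>

theorem theorem6p17:
  fixes \<alpha> :: "'a rel" and \<phi> :: "'b rel"
  assumes "Well_order \<alpha>"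
    and "has_cofinality \<alpha> unbounding_number"
    and "Linear_order \<phi>"
    and "countable (Field \<phi>)"
    and "typewise_decomposable TYPE('x) TYPE('y) \<phi>"
  shows "\<not> polarised \<alpha> \<phi> \<alpha> \<phi> one_otp \<phi>"
proof
  assume pol: "polarised \<alpha> \<phi> \<alpha> \<phi> one_otp \<phi>"
  obtain e :: "'b \<Rightarrow> rat"
    where e: "\<And>x y. x \<in> Field \<phi> \<Longrightarrow> y \<in> Field \<phi> \<Longrightarrow> e x \<le> e y \<longleftrightarrow> (x, y) \<in> \<phi>"
    using countable_linear_order_into_rat[OF assms(3,4)] by blast
  define P where "P = e ` Field \<phi>"
  obtain Z where Z: "small_tests P Z"
    using typewise_decomposable_imp_decomposed_order[OF assms(3) e assms(5)]
      decomposed_order.small_tests_exist unfolding P_def by blast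
  obtain f :: "'a \<Rightarrow> nat \<Rightarrow> nat" where f: "\<And>a. mono (f a)"
    "\<And>g. \<not> cofinal_subset {a \<in> Field \<alpha>. \<forall>n. f a n < g n} \<alpha>"
    using unbounded_assignment[OF assms(1,2)] by blast
  have large: "embeds P (e ` D)" if D: "D \<subseteq> Field \<phi>" "same_otp (Restr \<phi> D) \<phi>" for D
  proof -
    obtain i where i: "iso (Restr \<phi> D) \<phi> i" using D(2) unfolding same_otp_def by blast
    have "Field (Restr \<phi> D) = D"
      using D(1) assms(3) by (intro Refl_Field_Restr2) (simp_all add: order_on_defs)
    then have bij: "bij_betw i D (Field \<phi>)"
      and ord: "\<And>x y. x \<in> D \<Longrightarrow> y \<in> D \<Longrightarrow> (x, y) \<in> \<phi> \<longleftrightarrow> (i x, i y) \<in> \<phi>"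
      using i by (auto simp: iso_iff2)
    define j where "j p = e (inv_into D i (inv_into (Field \<phi>) e p))" for p
    show ?thesis
    proof (rule embedsI)
      have preimage: "\<exists>x\<in>D. e (i x) = p \<and> j p = e x" if "p \<in> P" for p
      proof -
        have "inv_into (Field \<phi>) e p \<in> Field \<phi>" "e (inv_into (Field \<phi>) e p) = p"
          using that unfolding P_def by (auto intro: inv_into_into f_inv_into_f)
        then show ?thesis
          using bij unfolding j_def bij_betw_def by (metis f_inv_into_f inv_into_into)
      qed
      then show "j p \<in> e ` D" if "p \<in> P" for p using that by blast
      fix p q assume "p \<in> P" "q \<in> P" "p < q"
      then obtain x y where xy: "x \<in> D" "y \<in> D" "p = e (i x)" "q = e (i y)" "j p = e x" "j q = e y"
        using preimage by metis
      moreover have "i x \<in> Field \<phi>" "i y \<in> Field \<phi>" using bij xy by (auto simp: bij_betw_def)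
      ultimately have "(i y, i x) \<notin> \<phi>" using \<open>p < q\<close> e[of "i y" "i x"] by simp
      then have "\<not> e y \<le> e x"
        using ord[OF xy(2,1)] e[of y x] D(1) xy(1,2) by auto
      then show "j p < j q" using xy by simp
    qed
  qed
  define c where "c = (\<lambda>(a, y). if e y \<in> Z (f a) then 1 else 0 :: nat)"
  have "Linear_order \<alpha>" using assms(1) by (simp add: well_order_on_def)
  moreover have "same_otp \<alpha> \<alpha>" "same_otp \<phi> \<phi>"
    unfolding same_otp_def iso_iff2 by (rule exI[of _ id], simp)+
  moreover have "c \<in> Field \<alpha> \<times> Field \<phi> \<rightarrow> {0, 1}" unfolding c_def by (auto split: if_splits)
  ultimately consider
    (zero) C D where "C \<subseteq> Field \<alpha>" "D \<subseteq> Field \<phi>" "same_otp (Restr \<alpha> C) \<alpha>"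
      "same_otp (Restr \<phi> D) \<phi>" "c ` (C \<times> D) \<subseteq> {0}" |
    (one) E D where "E \<subseteq> Field \<alpha>" "D \<subseteq> Field \<phi>" "same_otp (Restr \<alpha> E) one_otp"
      "same_otp (Restr \<phi> D) \<phi>" "c ` (E \<times> D) \<subseteq> {1}"
    using pol assms(3) unfolding polarised_def by meson
  then show False
  proof cases
    case zero
    have "e y \<notin> Z (f a)" if "a \<in> C" "y \<in> D" for a y
    proof -
      have "c (a, y) \<in> c ` (C \<times> D)" using that by blast
      then have "c (a, y) = 0" using zero(5) by blast
      then show ?thesis by (simp add: c_def split: if_splits)
    qed
    then have disj: "Z (f a) \<inter> e ` D = {}" if "a \<in> C" for a using that by blast
    have "e ` D \<subseteq> P" using zero(2) unfolding P_def by blast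
    then have "\<exists>g. \<forall>f. mono f \<longrightarrow> Z f \<inter> e ` D = {} \<longrightarrow> (\<forall>n. f n < g n)"
      using Z large[OF zero(2,4)] unfolding small_tests_def by simp
    then obtain g where g: "\<forall>f. mono f \<longrightarrow> Z f \<inter> e ` D = {} \<longrightarrow> (\<forall>n. f n < g n)" ..
    let ?E = "{a \<in> Field \<alpha>. \<forall>n. f a n < g n}"
    have "C \<subseteq> ?E"
    proof
      fix a assume "a \<in> C"
      then show "a \<in> ?E" using g[rule_format, OF f(1) disj] zero(1) by auto
    qed
    moreover have "cofinal_subset C \<alpha>" using assms(1) zero(1,3) by (rule cofinal_if_same_otp)
    ultimately have "cofinal_subset ?E \<alpha>" using cofinal_subset_mono[of C \<alpha> ?E] by auto
    then show False using f(2) by blast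
  next
    case one
    obtain i where "iso (Restr \<alpha> E) one_otp i" using one(3) unfolding same_otp_def by blast
    then have "Field (Restr \<alpha> E) \<noteq> {}"
      using iso_Field by (fastforce simp: one_otp_def Field_def)
    then obtain a where "a \<in> E" using Field_Restr_subset[of \<alpha> E] by blast
    have "e y \<in> Z (f a)" if "y \<in> D" for y
    proof -
      have "c (a, y) \<in> c ` (E \<times> D)" using that \<open>a \<in> E\<close> by blast
      then have "c (a, y) = 1" using one(5) by blast
      then show ?thesis by (simp add: c_def split: if_splits)
    qed
    then have "e ` D \<subseteq> Z (f a)" by blast
    with large[OF one(2,4)] have "embeds P (Z (f a))" by (rule embeds_mono)
    then show False using Z f(1) unfolding small_tests_def by blast
  qed
qed

end
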